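(* Let $\mathcal{X}$ be a uniformly smooth Banach space. Let $A\colon\Omega\to\mathcal{L}(\mathcal{X})$ be a random operator such that $\|A\|$ is bounded, regarded as the generator of the random semigroup $e^{At}$. Let $A, A_1, A_2, \ldots$ be a sequence of i.i.d. random operators. Then $e^{A_1t/n}\cdots e^{A_nt/n}$ converges almost surely in the strong operator topology of $\|\cdot\|_{\mathcal{X}}$ to $e^{(\mathbb{E}A)t}$, uniformly for $t$ in any segment; that is, for any $x\in\mathcal{X}$ and any $T>0$, almost surely $$\lim_{n\to\infty}\ \sup_{t\in[0,T]}\ \left\|\left(e^{A_1t/n}\cdots e^{A_nt/n}-e^{(\mathbb{E}A)t}\right)x\right\|=0.$$
   Context: Banach spaces are over $\mathbb{K}=\mathbb{R}$ or $\mathbb{C}$. $\mathcal{L}(\mathcal{X})$ is the Banach space (operator norm) of bounded linear operators $\mathcal{X}\to\mathcal{X}$. $(\Omega,\mathcal{F},\mathrm{P})$ is a probability space with a complete $\sigma$-additive measure. A Banach space $\mathcal{X}$ is uniformly smooth in the usual sense of Banach space theory; equivalently, it is $p$-smooth for some $p\in(1,2]$, meaning that there is $C>0$ with $\|x+y\|^p+\|x-y\|^p\le 2\|x\|^p+C\|y\|^p$ for all $x,y\in\mathcal{X}$ (this is the form in which the hypothesis is to be understood; the equivalence is up to equivalent renorming). A random element of a Banach space $\mathcal{Y}$ is a Bochner measurable map $\xi\colon\Omega\to\mathcal{Y}$; equivalently (Pettis), $\xi$ is weakly measurable ($\langle f,\xi\rangle$ is measurable for every $f\in\mathcal{Y}^*$)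 and almost surely takes values in a norm-separable subset of $\mathcal{Y}$. A random operator is a random element of a space of bounded linear operators (with the operator norm). $\mathbb{E}$ denotes the Bochner integral. Random elements $\xi_n\colon\Omega\to\mathcal{X}_n$ are independent if $\mathrm{P}\{\xi_1\in O_1,\ldots,\xi_n\in O_n\}=\mathrm{P}\{\xi_1\in O_1\}\cdots\mathrm{P}\{\xi_n\in O_n\}$ for all $n$ and all open $O_k\subset\mathcal{X}_k$; i.i.d. means independent and identically distributed. For a random operator $A$ with bounded norm, $e^{At}$ is the random uniformly continuous semigroup with infinitesimal generator $A$. *)

theory Defs
  imports "HOL-Probability.Probability"
begin

text \<open>
  Banach spaces over \<open>\<real>\<close> and over \<open>\<complex>\<close> are treated uniformly. By the Gelfand--Mazur theorem a type
  of class \<^class>\<open>real_normed_field\<close> is isometrically isomorphic to one of these two fields. The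
  library only has a class for real Banach spaces, so the scalar multiplication by \<open>'k\<close> is an
  explicit parameter, compatible with the underlying real Banach space.
\<close>

locale normed_space_over = vector_space smul
  for smul :: "'k::real_normed_field \<Rightarrow> 'a::real_normed_vector \<Rightarrow> 'a" +
  assumes norm_scale: "norm (smul c x) = norm c * norm x"
    and scale_of_real: "smul (of_real r) x = r *\<^sub>R x"

lemma normed_space_over_real:
  "normed_space_over (scaleR :: real \<Rightarrow> 'a::real_normed_vector \<Rightarrow> 'a)"
  by unfold_locales (simp_all add: algebra_simps)

lemma normed_space_over_complex: "normed_space_over ((*) :: complex \<Rightarrow> complex \<Rightarrow> complex)"
  by unfold_locales (simp_all add: algebra_simps norm_mult scaleR_conv_of_real)

text \<open>The elements of \<open>\<L>(\<X>)\<close>, as a real-linear subspace of the real-linear bounded operators.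
  The operator norm, and hence the topology, is inherited.\<close>

definition bounded_ops :: "('k::real_normed_field \<Rightarrow> 'a::real_normed_vector \<Rightarrow> 'a) \<Rightarrow> ('a \<Rightarrow>\<^sub>L 'a) set"
  where "bounded_ops smul = {T. Vector_Spaces.linear smul smul (blinfun_apply T)}"

definition p_smooth :: "'a::real_normed_vector itself \<Rightarrow> real \<Rightarrow> bool"
  where "p_smooth _ p \<longleftrightarrow> (\<exists>C>0. \<forall>x y :: 'a.
    norm (x + y) powr p + norm (x - y) powr p \<le> 2 * norm x powr p + C * norm y powr p)"

text \<open>Uniform smoothness is understood as \<open>p\<close>-smoothness of the given norm for some \<open>p \<in> (1,2]\<close>;
  the classical notion is equivalent to this up to passing to an equivalent norm.\<close>

definition uniformly_smooth :: "'a::real_normed_vector itself \<Rightarrow> bool"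
  where "uniformly_smooth X \<longleftrightarrow> (\<exists>p. 1 < p \<and> p \<le> 2 \<and> p_smooth X p)"

text \<open>The library's Bochner integral is restricted to second countable spaces, which excludes
  the operator space \<open>'a \<Rightarrow>\<^sub>L 'a\<close>. Borel measurability there does not provide an almost surely
  separable range, so Bochner measurability is defined by almost sure approximation by simple
  functions. For a map into the closed subspace \<open>bounded_ops\<close> it makes no difference whether the
  approximating functions take their values in the subspace or in the ambient space.\<close>

definition bochner_measurable :: "'w measure \<Rightarrow> ('w \<Rightarrow> 'b::real_normed_vector) \<Rightarrow> bool"
  where "bochner_measurable M f \<longleftrightarrow> (\<exists>s. (\<forall>i. simple_function M (s i)) \<and>
    (AE \<omega> in M. (\<lambda>i. s i \<omega>) \<longlonglongrightarrow> f \<omega>))"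

text \<open>On a complete measure space, the function \<open>\<lambda>\<omega>. norm (f \<omega> - s i \<omega>)\<close> below is measurable as
  soon as \<open>f\<close> is Bochner measurable.\<close>

definition has_bochner_expectation :: "'w measure \<Rightarrow> ('w \<Rightarrow> 'b::real_normed_vector) \<Rightarrow> 'b \<Rightarrow> bool"
  where "has_bochner_expectation M f m \<longleftrightarrow> bochner_measurable M f \<and>
    (\<exists>s. (\<forall>i. Bochner_Integration.simple_bochner_integrable M (s i)) \<and>
      (\<lambda>i. \<integral>\<^sup>+ \<omega>. ennreal (norm (f \<omega> - s i \<omega>)) \<partial>M) \<longlonglongrightarrow> 0 \<and>
      (\<lambda>i. Bochner_Integration.simple_bochner_integral M (s i)) \<longlonglongrightarrow> m)"

definition bochner_expectation :: "'w measure \<Rightarrow> ('w \<Rightarrow> 'b::real_normed_vector) \<Rightarrow> 'b"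
  where "bochner_expectation M f = (THE m. has_bochner_expectation M f m)"

text \<open>Wherever the library's integral applies, the two agree.\<close>

lemma bochner_expectation_eq_integral:
  fixes f :: "'w \<Rightarrow> 'b::{banach, second_countable_topology}"
  assumes "integrable M f"
  shows "bochner_expectation M f = integral\<^sup>L M f"
proof -
  have bf: "f \<in> borel_measurable M"
    using assms by auto
  then obtain s where "\<And>i. simple_function M (s i)"
    and "\<And>x. x \<in> space M \<Longrightarrow> (\<lambda>i. s i x) \<longlonglongrightarrow> f x"
    by (metis borel_measurable_implies_sequence_metric)
  then have "bochner_measurable M f"
    unfolding bochner_measurable_def by (auto intro!: exI[of _ s])
  then have "has_bochner_expectation M f m \<longleftrightarrow> has_bochner_integral M f m" for m
    unfolding has_bochner_expectation_def has_bochner_integral.simps using bf by auto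
  then show ?thesis
    using assms by (auto simp: bochner_expectation_def lebesgue_integral_def integrable.simps)
qed

definition random_operator ::
    "'w measure \<Rightarrow> ('k::real_normed_field \<Rightarrow> 'a::real_normed_vector \<Rightarrow> 'a) \<Rightarrow> ('w \<Rightarrow> 'a \<Rightarrow>\<^sub>L 'a) \<Rightarrow> bool"
  where "random_operator M smul A \<longleftrightarrow>
    (\<forall>\<omega>\<in>space M. A \<omega> \<in> bounded_ops smul) \<and> bochner_measurable M A"

text \<open>In the theorem, \<open>X 0\<close> is the generic operator \<open>A\<close> and \<open>X k\<close> is \<open>A\<^sub>k\<close> for \<open>k \<ge> 1\<close>. On a complete space Bochner measurable maps are Borel
  measurable; independence on open sets and on Borel sets agree by the \<open>\<pi>\<close>-\<open>\<lambda>\<close> theorem.\<close>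

definition iid :: "'w measure \<Rightarrow> (nat \<Rightarrow> 'w \<Rightarrow> 'b::topological_space) \<Rightarrow> bool"
  where "iid M X \<longleftrightarrow> prob_space.indep_vars M (\<lambda>_. borel) X UNIV \<and>
    (\<forall>i. distr M borel (X i) = distr M borel (X 0))"

text \<open>The type \<open>'a \<Rightarrow>\<^sub>L 'a\<close> is not an instance of \<^class>\<open>real_normed_algebra_1\<close> (the identity has norm
  \<open>0\<close> on the trivial space), so \<^const>\<open>exp\<close> is not available on it.\<close>

definition op_exp :: "('a::banach \<Rightarrow>\<^sub>L 'a) \<Rightarrow> ('a \<Rightarrow>\<^sub>L 'a)"
  where "op_exp T = (\<Sum>k. (1 / fact k) *\<^sub>R (((o\<^sub>L) T ^^ k) id_blinfun))"

text \<open>\<open>e\<^bsup>A\<^sub>1t/n\<^esup> \<cdots> e\<^bsup>A\<^sub>nt/n\<^esup>\<close>, with the factor of index \<open>1\<close> leftmost, that is, applied last.\<close>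

definition exp_product :: "(nat \<Rightarrow> 'w \<Rightarrow> ('a::banach \<Rightarrow>\<^sub>L 'a)) \<Rightarrow> nat \<Rightarrow> real \<Rightarrow> 'w \<Rightarrow> ('a \<Rightarrow>\<^sub>L 'a)"
  where "exp_product A n t \<omega> =
    foldr (\<lambda>k P. op_exp ((t / real n) *\<^sub>R A k \<omega>) o\<^sub>L P) [1..<Suc n] id_blinfun"

end

theory Submission
  imports Defs
begin

text \<open>
  The theorem is the strong law of large numbers in the operator space, combined with the fact that the
  product \<open>e\<^bsup>B\<^sub>1t/n\<^esup> \<cdots> e\<^bsup>B\<^sub>nt/n\<^esup>\<close> depends on bounded operators \<open>B\<^sub>k\<close> only through their partial sums, up
  to an error that vanishes with \<open>n\<close>. Convergence takes place even in the operator norm.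

  The deterministic half is \<open>exp_product_error_le\<close>. Write \<open>P\<^sub>k\<close> for the product of the first \<open>k\<close>
  factors, \<open>s = t/n\<close> and \<open>Q\<^sub>k = e\<^bsup>(n-k)sm\<^esup>\<close>. Then \<open>P\<^sub>n - e\<^bsup>tm\<^esup>\<close> telescopes into the sum of
  \<open>P\<^sub>k\<^sub>-\<^sub>1 (e\<^bsup>sB\<^sub>k\<^esup> - e\<^bsup>sm\<^esup>) Q\<^sub>k\<close>, and the middle factor is \<open>s (B\<^sub>k - m)\<close> up to \<open>O(s\<^sup>2)\<close>. Summation by parts
  moves the differences from \<open>D\<^sub>k = \<Sum>\<^sub>j\<^sub>\<le>\<^sub>k (B\<^sub>j - m)\<close> to \<open>P\<close> and \<open>Q\<close>, which vary by \<open>O(s)\<close> per step. What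
  remains is \<open>O(max\<^sub>k\<^sub>\<le>\<^sub>n \<parallel>D\<^sub>k\<parallel> / n) + O(1/n)\<close>, uniformly for \<open>t\<close> in \<open>[0,T]\<close>. If the averages of the
  \<open>B\<^sub>k\<close> tend to \<open>m\<close>, then \<open>\<parallel>D\<^sub>n\<parallel>/n \<rightarrow> 0\<close>, and the same is true of the running maximum.

  The probabilistic half is \<open>strong_law_bounded_bochner\<close>. A Bochner measurable map takes almost all its
  values, up to a set of small probability, in finitely many small balls. Rounding to the centres of
  these balls replaces the variables by variables with finitely many values, whose averages converge
  because the relative frequencies of finitely many events do. The frequency of an event converges
  almost surely by Hoeffding's inequality and the Borel-Cantelli lemma. The rounding error is controlled
  by the radius of the balls and the frequency of the exceptional set. The same rounded functions show
  that the Bochner expectation exists, and they compute it.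
\<close>

section \<open>The exponential of a bounded operator\<close>

lemma blinfun_compose_assoc: "(a o\<^sub>L b) o\<^sub>L c = a o\<^sub>L (b o\<^sub>L c)"
  by (rule blinfun_eqI) simp

lemma blinfun_compose_id [simp]: "id_blinfun o\<^sub>L a = a" "a o\<^sub>L id_blinfun = a"
  by (auto intro!: blinfun_eqI)

lemmas blinfun_compose_bilinear =
  bounded_bilinear.scaleR_left[OF bounded_bilinear_blinfun_compose]
  bounded_bilinear.scaleR_right[OF bounded_bilinear_blinfun_compose]
  bounded_bilinear.diff_left[OF bounded_bilinear_blinfun_compose]
  bounded_bilinear.diff_right[OF bounded_bilinear_blinfun_compose]
  bounded_bilinear.sum_left[OF bounded_bilinear_blinfun_compose]
  bounded_bilinear.sum_right[OF bounded_bilinear_blinfun_compose]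

definition op_pow :: "('a::real_normed_vector \<Rightarrow>\<^sub>L 'a) \<Rightarrow> nat \<Rightarrow> ('a \<Rightarrow>\<^sub>L 'a)"
  where "op_pow T k = ((o\<^sub>L) T ^^ k) id_blinfun"

lemma op_pow_0 [simp]: "op_pow T 0 = id_blinfun"
  and op_pow_Suc: "op_pow T (Suc k) = T o\<^sub>L op_pow T k"
  by (simp_all add: op_pow_def)

lemma op_pow_add: "op_pow T (j + k) = op_pow T j o\<^sub>L op_pow T k"
  by (induction j) (simp_all add: op_pow_Suc blinfun_compose_assoc)

lemma op_pow_scaleR: "op_pow (a *\<^sub>R T) k = a ^ k *\<^sub>R op_pow T k"
  by (induction k) (simp_all add: op_pow_Suc blinfun_compose_bilinear mult.commute)

lemma norm_op_pow_le: "norm (op_pow T k) \<le> norm T ^ k"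
proof (induction k)
  case 0
  then show ?case by (simp add: norm_blinfun_id_le)
next
  case (Suc k)
  then show ?case
    unfolding op_pow_Suc power_Suc
    by (intro order_trans[OF norm_blinfun_compose] mult_left_mono) auto
qed

definition exp_partial :: "nat \<Rightarrow> ('a::real_normed_vector \<Rightarrow>\<^sub>L 'a) \<Rightarrow> ('a \<Rightarrow>\<^sub>L 'a)"
  where "exp_partial N T = (\<Sum>k<N. (1 / fact k) *\<^sub>R op_pow T k)"

lemma norm_exp_term_le: "norm ((1 / fact k) *\<^sub>R op_pow T k) \<le> norm T ^ k / fact k"
  using norm_op_pow_le[of T k] by (simp add: divide_simps)

lemma real_exp_sums: "(\<lambda>k. x ^ k / fact k) sums exp (x::real)"
  using exp_converges[of x] by (simp add: field_simps)

lemma exp_partial_tendsto: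
  fixes T :: "'a::banach \<Rightarrow>\<^sub>L 'a"
  shows "(\<lambda>N. exp_partial N T) \<longlonglongrightarrow> op_exp T"
proof -
  have "summable (\<lambda>k. (1 / fact k) *\<^sub>R op_pow T k)"
    by (rule summable_comparison_test'[OF sums_summable[OF real_exp_sums], of 0])
      (rule norm_exp_term_le)
  then show ?thesis
    unfolding exp_partial_def op_exp_def op_pow_def by (rule summable_LIMSEQ)
qed

text \<open>
  The remainder of the operator series is dominated term by term by the remainder of the real series of
  \<open>e\<^bsup>\<parallel>T\<parallel>\<^esup>\<close>. The cases \<open>N = 0, 1, 2\<close> are the three estimates for \<open>e\<^bsup>T\<^esup>\<close> that the product needs.
\<close>

lemma norm_op_exp_minus_partial_le:
  fixes T :: "'a::banach \<Rightarrow>\<^sub>L 'a"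
  shows "norm (op_exp T - exp_partial N T) \<le> exp (norm T) - (\<Sum>k<N. norm T ^ k / fact k)"
proof (rule tendsto_le[OF sequentially_bot])
  show "(\<lambda>M. norm (exp_partial M T - exp_partial N T)) \<longlonglongrightarrow> norm (op_exp T - exp_partial N T)"
    by (intro tendsto_intros exp_partial_tendsto)
  show "(\<lambda>M. (\<Sum>k<M. norm T ^ k / fact k) - (\<Sum>k<N. norm T ^ k / fact k))
      \<longlonglongrightarrow> exp (norm T) - (\<Sum>k<N. norm T ^ k / fact k)"
    using real_exp_sums[of "norm T"] by (intro tendsto_intros) (simp add: sums_def)
  have "norm (exp_partial M T - exp_partial N T)
      \<le> (\<Sum>k<M. norm T ^ k / fact k) - (\<Sum>k<N. norm T ^ k / fact k)" if "N \<le> M" for M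
  proof -
    have *: "{..<M} - {..<N} = {N..<M}" by auto
    have "exp_partial M T - exp_partial N T = (\<Sum>k=N..<M. (1 / fact k) *\<^sub>R op_pow T k)"
      unfolding exp_partial_def using that by (subst sum_diff[symmetric]) (auto simp: *)
    also have "norm \<dots> \<le> (\<Sum>k=N..<M. norm T ^ k / fact k)"
      by (intro sum_norm_le norm_exp_term_le)
    also have "\<dots> = (\<Sum>k<M. norm T ^ k / fact k) - (\<Sum>k<N. norm T ^ k / fact k)"
      using that by (subst sum_diff[symmetric]) (auto simp: *)
    finally show ?thesis .
  qed
  then show "\<forall>\<^sub>F M in sequentially. norm (exp_partial M T - exp_partial N T)
      \<le> (\<Sum>k<M. norm T ^ k / fact k) - (\<Sum>k<N. norm T ^ k / fact k)"
    by (auto simp: eventually_sequentially)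
qed

lemma exp_minus_1_le: "exp x - 1 \<le> x * exp (x::real)"
proof -
  have "1 - x \<le> exp (- x)"
    using exp_ge_add_one_self[of "-x"] by simp
  then have "(1 - x) * exp x \<le> exp (- x) * exp x"
    by (rule mult_right_mono) simp
  then show ?thesis
    by (simp add: algebra_simps flip: exp_add)
qed

lemma norm_op_exp_le:
  fixes T :: "'a::banach \<Rightarrow>\<^sub>L 'a"
  shows "norm (op_exp T) \<le> exp (norm T)"
  using norm_op_exp_minus_partial_le[of T 0] by (simp add: exp_partial_def)

lemma norm_op_exp_minus_id_le:
  fixes T :: "'a::banach \<Rightarrow>\<^sub>L 'a"
  shows "norm (op_exp T - id_blinfun) \<le> norm T * exp (norm T)"
  using norm_op_exp_minus_partial_le[of T 1] exp_minus_1_le[of "norm T"]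
  by (simp add: exp_partial_def)

lemma norm_op_exp_minus_linear_le:
  fixes T :: "'a::banach \<Rightarrow>\<^sub>L 'a"
  shows "norm (op_exp T - id_blinfun - T) \<le> (norm T)\<^sup>2 * exp (norm T)"
proof -
  have "norm (op_exp T - id_blinfun - T) \<le> exp (norm T) - 1 - norm T"
    using norm_op_exp_minus_partial_le[of T 2]
    by (simp add: exp_partial_def numeral_2_eq_2 op_pow_Suc algebra_simps)
  also have "\<dots> \<le> norm T * (exp (norm T) - 1)"
    using exp_minus_1_le[of "norm T"] by (simp add: algebra_simps)
  also have "\<dots> \<le> norm T * (norm T * exp (norm T))"
    by (intro mult_left_mono exp_minus_1_le) simp
  finally show ?thesis
    by (simp add: power2_eq_square)
qed

lemma op_exp_0 [simp]: "op_exp (0::'a::banach \<Rightarrow>\<^sub>L 'a) = id_blinfun"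
  using norm_op_exp_minus_id_le[of "0::'a \<Rightarrow>\<^sub>L 'a"] by simp

text \<open>
  The Cauchy product of two exponential series differs from the series of the sum, at level \<open>N\<close>, by the
  terms with \<open>j, k < N \<le> j + k\<close>. Since \<open>a, b \<ge> 0\<close>, their norms add up to at most the same difference
  for the real numbers \<open>a\<parallel>T\<parallel>\<close> and \<open>b\<parallel>T\<parallel>\<close>, which tends to \<open>0\<close> by the addition theorem of the real
  exponential function.
\<close>

lemma op_exp_add_scaleR:
  fixes T :: "'a::banach \<Rightarrow>\<^sub>L 'a"
  assumes "0 \<le> a" "0 \<le> b"
  shows "op_exp ((a + b) *\<^sub>R T) = op_exp (a *\<^sub>R T) o\<^sub>L op_exp (b *\<^sub>R T)"
proof -
  define r where "r = norm T"
  define c where "c = (\<lambda>(j, k). a ^ j * b ^ k / (fact j * fact k))"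
  \<comment> \<open>The product of the partial sums ranges over a square of indices, the partial sum at \<open>a + b\<close>
    over the triangle below its antidiagonal.\<close>
  define B where "B N = {..<N} \<times> {..<N}" for N :: nat
  define L where "L N = {(j, k). j + k < N}" for N :: nat
  have fin: "finite (B N)" "L N \<subseteq> B N" for N
    by (auto simp: B_def L_def)
  have c_nonneg: "0 \<le> c p" for p
    using assms by (auto simp: c_def split: prod.split)
  have binomial: "(\<Sum>j\<le>n. c (j, n - j)) = (a + b) ^ n / fact n" for n
    unfolding binomial_ring c_def sum_divide_distrib
    by (rule sum.cong[OF refl]) (auto simp: binomial_fact)
  have triangle: "(\<Sum>(j, k)\<in>L N. c (j, k) *\<^sub>R op_pow T (j + k)) = exp_partial N ((a + b) *\<^sub>R T)" for N
  proof -
    have "(\<Sum>(j, k)\<in>L N. c (j, k) *\<^sub>R op_pow T (j + k))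
        = (\<Sum>n<N. \<Sum>j\<le>n. c (j, n - j) *\<^sub>R op_pow T n)"
      unfolding L_def by (subst sum.triangle_reindex) simp
    also have "\<dots> = (\<Sum>n<N. (\<Sum>j\<le>n. c (j, n - j)) *\<^sub>R op_pow T n)"
      by (simp add: scaleR_left.sum)
    finally show ?thesis
      by (simp add: binomial exp_partial_def op_pow_scaleR)
  qed
  have triangle': "(\<Sum>(j, k)\<in>L N. c (j, k) * r ^ (j + k)) = (\<Sum>n<N. ((a + b) * r) ^ n / fact n)" for N
  proof -
    have "(\<Sum>(j, k)\<in>L N. c (j, k) * r ^ (j + k))
        = (\<Sum>n<N. \<Sum>j\<le>n. c (j, n - j) * r ^ n)"
      unfolding L_def by (subst sum.triangle_reindex) simp
    then show ?thesis
      by (simp add: binomial power_mult_distrib flip: sum_distrib_right)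
  qed
  have square: "(\<Sum>(j, k)\<in>B N. c (j, k) *\<^sub>R op_pow T (j + k))
      = exp_partial N (a *\<^sub>R T) o\<^sub>L exp_partial N (b *\<^sub>R T)" for N
    unfolding B_def exp_partial_def
    by (simp add: c_def blinfun_compose_bilinear sum.cartesian_product[symmetric]
        op_pow_scaleR op_pow_add)
      (subst sum.swap, simp add: scaleR_sum_right mult_ac)
  have square': "(\<Sum>(j, k)\<in>B N. c (j, k) * r ^ (j + k))
      = (\<Sum>n<N. (a * r) ^ n / fact n) * (\<Sum>n<N. (b * r) ^ n / fact n)" for N
    unfolding B_def sum_product
    by (simp add: c_def sum.cartesian_product power_add power_mult_distrib mult_ac)
  have bound: "norm ((exp_partial N (a *\<^sub>R T) o\<^sub>L exp_partial N (b *\<^sub>R T)) - exp_partial N ((a + b) *\<^sub>R T))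
      \<le> (\<Sum>n<N. (a * r) ^ n / fact n) * (\<Sum>n<N. (b * r) ^ n / fact n)
        - (\<Sum>n<N. ((a + b) * r) ^ n / fact n)" for N
  proof -
    have "(exp_partial N (a *\<^sub>R T) o\<^sub>L exp_partial N (b *\<^sub>R T)) - exp_partial N ((a + b) *\<^sub>R T)
        = (\<Sum>(j, k)\<in>B N - L N. c (j, k) *\<^sub>R op_pow T (j + k))"
      unfolding triangle[symmetric] using fin by (simp add: sum_diff square)
    also have "norm \<dots> \<le> (\<Sum>(j, k)\<in>B N - L N. c (j, k) * r ^ (j + k))"
      using c_nonneg by (intro sum_norm_le) (auto simp: r_def intro!: mult_left_mono norm_op_pow_le)
    also have "\<dots> = (\<Sum>n<N. (a * r) ^ n / fact n) * (\<Sum>n<N. (b * r) ^ n / fact n)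
        - (\<Sum>n<N. ((a + b) * r) ^ n / fact n)"
      unfolding triangle'[symmetric] using fin by (simp add: sum_diff square')
    finally show ?thesis .
  qed
  have "(\<lambda>N. (\<Sum>n<N. (a * r) ^ n / fact n) * (\<Sum>n<N. (b * r) ^ n / fact n)
        - (\<Sum>n<N. ((a + b) * r) ^ n / fact n)) \<longlonglongrightarrow> exp (a * r) * exp (b * r) - exp ((a + b) * r)"
    using real_exp_sums unfolding sums_def by (intro tendsto_intros)
  then have lim0: "(\<lambda>N. (\<Sum>n<N. (a * r) ^ n / fact n) * (\<Sum>n<N. (b * r) ^ n / fact n)
        - (\<Sum>n<N. ((a + b) * r) ^ n / fact n)) \<longlonglongrightarrow> 0"
    by (simp add: distrib_right exp_add)
  have "(\<lambda>N. (exp_partial N (a *\<^sub>R T) o\<^sub>L exp_partial N (b *\<^sub>R T)) - exp_partial N ((a + b) *\<^sub>R T)) \<longlonglongrightarrow> 0"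
    by (rule Lim_null_comparison[OF _ lim0]) (use bound in auto)
  moreover have "(\<lambda>N. (exp_partial N (a *\<^sub>R T) o\<^sub>L exp_partial N (b *\<^sub>R T)) - exp_partial N ((a + b) *\<^sub>R T))
      \<longlonglongrightarrow> (op_exp (a *\<^sub>R T) o\<^sub>L op_exp (b *\<^sub>R T)) - op_exp ((a + b) *\<^sub>R T)"
    by (intro tendsto_intros exp_partial_tendsto)
  ultimately show ?thesis
    using LIMSEQ_unique by fastforce
qed

section \<open>Products of exponentials and averages of their exponents\<close>

text \<open>
  A product \<open>P n\<close> of factors \<open>F\<close> is compared with a power of \<open>G\<close> by exchanging one factor at a time.
  Here \<open>Q k\<close> stands for the remaining \<open>n - k\<close> factors \<open>G\<close>. When \<open>F - G\<close> is \<open>s\<close> times an increment of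
  \<open>D\<close>, up to a remainder \<open>R\<close>, summation by parts leaves no increments of \<open>D\<close>: they need not be small,
  while \<open>D\<close> itself is going to be \<open>o(n)\<close>.
\<close>

lemma abel_telescope:
  fixes P Q D R :: "nat \<Rightarrow> ('a::real_normed_vector \<Rightarrow>\<^sub>L 'a)"
  assumes D0: "D 0 = 0"
    and P: "\<And>k. P (Suc k) = P k o\<^sub>L F (Suc k)"
    and Q: "\<And>k. k < n \<Longrightarrow> Q k = G o\<^sub>L Q (Suc k)"
    and FG: "\<And>k. F (Suc k) - G = s *\<^sub>R (D (Suc k) - D k) + R k"
  shows "(P n o\<^sub>L Q n) - (P 0 o\<^sub>L Q 0) =
      s *\<^sub>R ((P n o\<^sub>L D n o\<^sub>L Q n)
        - (\<Sum>k<n. ((P (Suc k) - P k) o\<^sub>L D (Suc k) o\<^sub>L Q (Suc k)))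
        + (\<Sum>k<n. (P k o\<^sub>L D k o\<^sub>L (Q k - Q (Suc k)))))
      + (\<Sum>k<n. (P k o\<^sub>L R k o\<^sub>L Q (Suc k)))"
proof -
  let ?V = "\<lambda>k. P k o\<^sub>L D k o\<^sub>L Q k"
  have "(P n o\<^sub>L Q n) - (P 0 o\<^sub>L Q 0) = (\<Sum>k<n. (P (Suc k) o\<^sub>L Q (Suc k)) - (P k o\<^sub>L Q k))"
    by (simp add: sum_lessThan_telescope[of "\<lambda>k. (P k o\<^sub>L Q k)"])
  also have "\<dots> = (\<Sum>k<n. s *\<^sub>R (?V (Suc k) - ?V k) - s *\<^sub>R ((P (Suc k) - P k) o\<^sub>L D (Suc k) o\<^sub>L Q (Suc k))
      + s *\<^sub>R (P k o\<^sub>L D k o\<^sub>L (Q k - Q (Suc k))) + (P k o\<^sub>L R k o\<^sub>L Q (Suc k)))"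
  proof (rule sum.cong[OF refl])
    fix k assume "k \<in> {..<n}"
    then have "(P (Suc k) o\<^sub>L Q (Suc k)) - (P k o\<^sub>L Q k) = P k o\<^sub>L (F (Suc k) - G) o\<^sub>L Q (Suc k)"
      by (auto intro!: blinfun_eqI simp: P Q blinfun.bilinear_simps)
    also have "\<dots> = s *\<^sub>R (P k o\<^sub>L (D (Suc k) - D k) o\<^sub>L Q (Suc k)) + (P k o\<^sub>L R k o\<^sub>L Q (Suc k))"
      by (auto intro!: blinfun_eqI simp: FG blinfun.bilinear_simps)
    also have "(P k o\<^sub>L (D (Suc k) - D k) o\<^sub>L Q (Suc k))
        = (?V (Suc k) - ?V k) - ((P (Suc k) - P k) o\<^sub>L D (Suc k) o\<^sub>L Q (Suc k))
          + (P k o\<^sub>L D k o\<^sub>L (Q k - Q (Suc k)))"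
      by (auto intro!: blinfun_eqI simp: blinfun.bilinear_simps)
    finally show "(P (Suc k) o\<^sub>L Q (Suc k)) - (P k o\<^sub>L Q k)
        = s *\<^sub>R (?V (Suc k) - ?V k) - s *\<^sub>R ((P (Suc k) - P k) o\<^sub>L D (Suc k) o\<^sub>L Q (Suc k))
          + s *\<^sub>R (P k o\<^sub>L D k o\<^sub>L (Q k - Q (Suc k))) + (P k o\<^sub>L R k o\<^sub>L Q (Suc k))"
      by (simp add: algebra_simps)
  qed
  also have "\<dots> = s *\<^sub>R (\<Sum>k<n. ?V (Suc k) - ?V k)
      - s *\<^sub>R (\<Sum>k<n. ((P (Suc k) - P k) o\<^sub>L D (Suc k) o\<^sub>L Q (Suc k)))
      + s *\<^sub>R (\<Sum>k<n. (P k o\<^sub>L D k o\<^sub>L (Q k - Q (Suc k)))) + (\<Sum>k<n. (P k o\<^sub>L R k o\<^sub>L Q (Suc k)))"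
    by (simp only: sum.distrib sum_subtractf scaleR_sum_right scaleR_diff_right)
  also have "(\<Sum>k<n. ?V (Suc k) - ?V k) = ?V n"
    using D0 by (subst sum_lessThan_telescope) simp
  finally show ?thesis
    by (simp add: algebra_simps)
qed

lemma norm_compose3_le:
  assumes "norm a \<le> x" "norm b \<le> y" "norm c \<le> z"
  shows "norm (a o\<^sub>L b o\<^sub>L c) \<le> x * y * z"
proof -
  have "0 \<le> x" "0 \<le> y" "0 \<le> z" using assms norm_ge_zero order_trans by blast+
  then show ?thesis
    by (intro order_trans[OF norm_blinfun_compose] mult_mono) (use assms in auto)
qed

lemma foldr_compose_snoc:
  "foldr (\<lambda>k P. F k o\<^sub>L P) (xs @ [y]) id_blinfun = foldr (\<lambda>k P. F k o\<^sub>L P) xs id_blinfun o\<^sub>L F y"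
proof -
  have "foldr (\<lambda>k P. F k o\<^sub>L P) xs B = foldr (\<lambda>k P. F k o\<^sub>L P) xs id_blinfun o\<^sub>L B" for B
    by (induction xs) (simp_all add: blinfun_compose_assoc)
  from this[of "F y"] show ?thesis by simp
qed

text \<open>
  In the first two sums of \<open>abel_telescope\<close>, each of the \<open>n\<close> summands contains an increment of \<open>P\<close> or of
  \<open>Q\<close>, of norm \<open>O(1/n)\<close>. So these sums, like the boundary term, are of order \<open>\<delta>\<close>, and the prefactor
  \<open>s \<le> T/n\<close> turns this into \<open>\<delta>/n\<close>. The \<open>n\<close> remainders are of order \<open>1/n\<^sup>2\<close> each. All partial products
  of exponentials have norm at most \<open>e\<^bsup>KT\<^esup>\<close>.
\<close>

lemma exp_product_error_le:
  fixes B :: "nat \<Rightarrow> ('a::banach \<Rightarrow>\<^sub>L 'a)"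
  assumes B: "\<And>k. 1 \<le> k \<Longrightarrow> norm (B k) \<le> K" and m: "norm m \<le> K"
    and n: "1 \<le> n" and t: "0 \<le> t" "t \<le> T"
    and \<delta>: "\<And>k. k \<le> n \<Longrightarrow> norm (\<Sum>j=1..k. B j - m) \<le> \<delta>"
  shows "norm (foldr (\<lambda>k P. op_exp ((t / real n) *\<^sub>R B k) o\<^sub>L P) [1..<Suc n] id_blinfun - op_exp (t *\<^sub>R m))
    \<le> T * exp (K * T) ^ 2 * (1 + 2 * K * T * exp (K * T)) * (\<delta> / real n)
       + 2 * (K * T)\<^sup>2 * exp (K * T) ^ 3 / real n"
proof -
  define s where "s = t / real n"
  define E where "E = exp (K * T)"
  define F where "F k = op_exp (s *\<^sub>R B k)" for k
  define P where "P k = foldr (\<lambda>k P. F k o\<^sub>L P) [1..<Suc k] id_blinfun" for k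
  define G where "G = op_exp (s *\<^sub>R m)"
  define Q where "Q k = op_exp ((real (n - k) * s) *\<^sub>R m)" for k
  define D where "D k = (\<Sum>j=1..k. B j - m)" for k
  define R where "R k = F (Suc k) - G - s *\<^sub>R (D (Suc k) - D k)" for k
  have K: "0 \<le> K" using m norm_ge_zero order_trans by blast
  have s: "0 \<le> s" "real n * s = t" using t n by (simp_all add: s_def)
  have kst: "real k * s \<le> T" if "k \<le> n" for k
    using that s t by (metis mult_right_mono of_nat_le_iff order_trans)
  have sT: "s \<le> T" using kst[of 1] n by simp
  have E1: "1 \<le> E" using K t by (simp add: E_def)
  have D\<delta>: "norm (D k) \<le> \<delta>" if "k \<le> n" for k
    using \<delta>[OF that] by (simp add: D_def)
  have \<delta>0: "0 \<le> \<delta>" using D\<delta>[of 0] by (simp add: D_def)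
  have P_Suc: "P (Suc k) = P k o\<^sub>L F (Suc k)" for k
    unfolding P_def by (simp only: upt_Suc_append[of 1 "Suc k"] foldr_compose_snoc)
  have Q_Suc: "Q k = G o\<^sub>L Q (Suc k)" if "k < n" for k
  proof -
    have "real (n - k) = 1 + real (n - Suc k)" using that by simp
    then have "real (n - k) * s = s + real (n - Suc k) * s"
      by (simp only: distrib_right mult_1_left)
    then show ?thesis
      unfolding Q_def G_def using op_exp_add_scaleR[of s "real (n - Suc k) * s" m] s by simp
  qed
  have snorm: "norm (s *\<^sub>R C) \<le> K * s" "norm (s *\<^sub>R C) \<le> K * T" if "norm C \<le> K" for C :: "'a \<Rightarrow>\<^sub>L 'a"
    using that s mult_left_mono[OF that s(1)] mult_left_mono[OF sT K] by (auto simp: mult.commute)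
  have exp1: "norm (op_exp (s *\<^sub>R C) - id_blinfun) \<le> K * s * E" if "norm C \<le> K" for C :: "'a \<Rightarrow>\<^sub>L 'a"
    using snorm[OF that] K s unfolding E_def
    by (intro order_trans[OF norm_op_exp_minus_id_le] mult_mono) auto
  have exp2: "norm (op_exp (s *\<^sub>R C) - id_blinfun - s *\<^sub>R C) \<le> (K * s)\<^sup>2 * E" if "norm C \<le> K" for C :: "'a \<Rightarrow>\<^sub>L 'a"
    using snorm[OF that] K s unfolding E_def
    by (intro order_trans[OF norm_op_exp_minus_linear_le] mult_mono power_mono) auto
  have normP: "norm (P k) \<le> E" if "k \<le> n" for k
  proof -
    have "norm (P k) \<le> exp (K * s) ^ k"
    proof (induction k)
      case 0
      then show ?case by (simp add: P_def norm_blinfun_id_le)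
    next
      case (Suc k)
      have "norm (F (Suc k)) \<le> exp (K * s)"
        unfolding F_def using snorm(1)[OF B[of "Suc k"]]
        by (intro order_trans[OF norm_op_exp_le]) auto
      then have "norm (P k) * norm (F (Suc k)) \<le> exp (K * s) ^ k * exp (K * s)"
        using Suc by (intro mult_mono) auto
      then show ?case
        unfolding P_Suc power_Suc2 by (rule order_trans[OF norm_blinfun_compose])
    qed
    also have "\<dots> = exp (K * (real k * s))"
      by (simp add: exp_of_nat_mult[symmetric] mult_ac)
    also have "\<dots> \<le> E"
      unfolding E_def using kst[OF that] K by (simp add: mult_left_mono)
    finally show ?thesis .
  qed
  have normQ: "norm (Q k) \<le> E" for k
  proof -
    have "norm ((real (n - k) * s) *\<^sub>R m) \<le> T * K"
      using kst[of "n - k"] s t m by (simp add: abs_mult) (intro mult_mono, auto)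
    then show ?thesis
      unfolding Q_def E_def by (intro order_trans[OF norm_op_exp_le]) (simp add: mult.commute)
  qed
  have normR: "norm (R k) \<le> 2 * (K * s)\<^sup>2 * E" for k
  proof -
    have "R k = (F (Suc k) - id_blinfun - s *\<^sub>R B (Suc k)) - (G - id_blinfun - s *\<^sub>R m)"
      by (simp add: R_def D_def algebra_simps)
    also have "norm \<dots> \<le> (K * s)\<^sup>2 * E + (K * s)\<^sup>2 * E"
      unfolding F_def G_def by (intro order_trans[OF norm_triangle_ineq4] add_mono exp2 B m) simp
    finally show ?thesis by (simp add: mult_ac)
  qed
  have normdP: "norm (P (Suc k) - P k) \<le> E * (K * s * E)" if "k < n" for k
  proof -
    have "P (Suc k) - P k = P k o\<^sub>L (F (Suc k) - id_blinfun)"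
      by (simp add: P_Suc blinfun_compose_bilinear)
    also have "norm \<dots> \<le> E * (K * s * E)"
      unfolding F_def using normP[of k] exp1[OF B[of "Suc k"]] that E1
      by (intro order_trans[OF norm_blinfun_compose] mult_mono) auto
    finally show ?thesis .
  qed
  have normdQ: "norm (Q k - Q (Suc k)) \<le> (K * s * E) * E" if "k < n" for k
  proof -
    have "Q k - Q (Suc k) = (G - id_blinfun) o\<^sub>L Q (Suc k)"
      by (simp add: Q_Suc[OF that] blinfun_compose_bilinear)
    also have "norm \<dots> \<le> (K * s * E) * E"
      unfolding G_def using normQ[of "Suc k"] exp1[OF m] E1 K s
      by (intro order_trans[OF norm_blinfun_compose] mult_mono) auto
    finally show ?thesis .
  qed
  let ?S1 = "\<Sum>k<n. ((P (Suc k) - P k) o\<^sub>L D (Suc k) o\<^sub>L Q (Suc k))"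
  let ?S2 = "\<Sum>k<n. (P k o\<^sub>L D k o\<^sub>L (Q k - Q (Suc k)))"
  let ?S3 = "\<Sum>k<n. (P k o\<^sub>L R k o\<^sub>L Q (Suc k))"
  have V: "norm (P n o\<^sub>L D n o\<^sub>L Q n) \<le> E * \<delta> * E"
    by (intro norm_compose3_le normP normQ D\<delta>) auto
  have S1: "norm ?S1 \<le> real n * (E * (K * s * E) * \<delta> * E)"
    using sum_norm_bound[of "{..<n}" "\<lambda>k. ((P (Suc k) - P k) o\<^sub>L D (Suc k) o\<^sub>L Q (Suc k))"]
    by (simp add: norm_compose3_le normdP normQ D\<delta>)
  have S2: "norm ?S2 \<le> real n * (E * \<delta> * (K * s * E * E))"
    using sum_norm_bound[of "{..<n}" "\<lambda>k. (P k o\<^sub>L D k o\<^sub>L (Q k - Q (Suc k)))"]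
    by (simp add: norm_compose3_le normdQ normP D\<delta>)
  have S3: "norm ?S3 \<le> real n * (E * (2 * (K * s)\<^sup>2 * E) * E)"
    using sum_norm_bound[of "{..<n}" "\<lambda>k. (P k o\<^sub>L R k o\<^sub>L Q (Suc k))"]
    by (simp add: norm_compose3_le normQ normP normR)
  have "P n - op_exp (t *\<^sub>R m) = (P n o\<^sub>L Q n) - (P 0 o\<^sub>L Q 0)"
    by (simp add: P_def Q_def s)
  also have "\<dots> = s *\<^sub>R ((P n o\<^sub>L D n o\<^sub>L Q n) - ?S1 + ?S2) + ?S3"
    by (rule abel_telescope[where F = F and G = G]) (auto simp: D_def R_def P_Suc Q_Suc)
  also have "norm \<dots> \<le> s * (E * \<delta> * E + real n * (E * (K * s * E) * \<delta> * E)
      + real n * (E * \<delta> * (K * s * E * E))) + real n * (E * (2 * (K * s)\<^sup>2 * E) * E)"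
  proof (intro order_trans[OF norm_triangle_ineq] add_mono S3)
    have "norm ((P n o\<^sub>L D n o\<^sub>L Q n) - ?S1 + ?S2) \<le> E * \<delta> * E + real n * (E * (K * s * E) * \<delta> * E)
      + real n * (E * \<delta> * (K * s * E * E))"
      by (intro order_trans[OF norm_triangle_ineq] order_trans[OF norm_triangle_ineq4] add_mono V S1 S2)
    then show "norm (s *\<^sub>R ((P n o\<^sub>L D n o\<^sub>L Q n) - ?S1 + ?S2)) \<le> s * (E * \<delta> * E
        + real n * (E * (K * s * E) * \<delta> * E) + real n * (E * \<delta> * (K * s * E * E)))"
      using s by (simp add: mult_left_mono)
  qed
  also have "\<dots> = t * E\<^sup>2 * (1 + 2 * K * t * E) * (\<delta> / real n) + 2 * (K * t)\<^sup>2 * E ^ 3 / real n"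
    using n unfolding s_def by (simp add: field_simps power2_eq_square power3_eq_cube)
  also have "\<dots> \<le> T * E\<^sup>2 * (1 + 2 * K * T * E) * (\<delta> / real n) + 2 * (K * T)\<^sup>2 * E ^ 3 / real n"
    using t K E1 \<delta>0
    by (intro add_mono mult_mono divide_right_mono mult_left_mono power_mono add_nonneg_nonneg mult_nonneg_nonneg) auto
  finally show ?thesis
    unfolding P_def F_def s_def E_def by simp
qed

text \<open>
  Summation by parts involves all partial sums up to \<open>n\<close>, not only the last one. The indices below a fixed
  \<open>N\<close> contribute a constant to the maximum, and the others at most \<open>\<epsilon> n\<close>.
\<close>

lemma running_max_over_n_tendsto_0:
  fixes d :: "nat \<Rightarrow> real"
  assumes "(\<lambda>n. d n / real n) \<longlonglongrightarrow> 0" and "\<And>n. 0 \<le> d n"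
  shows "(\<lambda>n. Max (d ` {..n}) / real n) \<longlonglongrightarrow> 0"
proof (rule LIMSEQ_I)
  fix e :: real assume e: "0 < e"
  from LIMSEQ_D[OF assms(1), of "e / 2"] e obtain N where N: "\<forall>n\<ge>N. norm (d n / real n - 0) < e / 2"
    by auto
  define c where "c = Max (d ` {..N})"
  obtain N' where N': "2 * c / e < real N'" using reals_Archimedean2 by blast
  have "norm (Max (d ` {..n}) / real n - 0) < e" if n: "n \<ge> max (max N N') 1" for n
  proof -
    have c: "c < e * real n / 2"
    proof -
      have "2 * c / e < real n" using N' n by linarith
      then show ?thesis using e by (simp add: field_simps)
    qed
    have "d k < e * real n" if "k \<le> n" for k
    proof (cases "k \<le> N")
      case True
      then have "d k \<le> c" unfolding c_def by (intro Max_ge) auto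
      moreover have "e * real n > 0" using e n by auto
      ultimately show ?thesis using c by linarith
    next
      case False
      then have "norm (d k / real k - 0) < e / 2" using N by auto
      then have "d k / real k < e / 2" using assms(2)[of k] by simp
      then have "d k < e / 2 * real k" using False by (simp add: pos_divide_less_eq)
      also have "\<dots> \<le> e / 2 * real n" using that e by simp
      also have "\<dots> < e * real n" using e n by auto
      finally show ?thesis .
    qed
    then have "Max (d ` {..n}) < e * real n" by (subst Max_less_iff) auto
    then have "Max (d ` {..n}) / real n < e"
      using n by (subst pos_divide_less_eq) auto
    moreover have "0 \<le> Max (d ` {..n})"
      by (rule order_trans[OF assms(2)[of 0] Max_ge]) auto
    ultimately show ?thesis
      by (simp del: Max_less_iff)
  qed
  then show "\<exists>no. \<forall>n\<ge>no. norm (Max (d ` {..n}) / real n - 0) < e" by blast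
qed

text \<open>
  The error bound does not depend on \<open>t\<close>. It also makes the supremum range over a bounded set, so that
  the supremum is a genuine one.
\<close>

lemma exp_product_SUP_tendsto_0:
  fixes B :: "nat \<Rightarrow> ('a::banach \<Rightarrow>\<^sub>L 'a)" and x :: 'a
  assumes B: "\<And>k. 1 \<le> k \<Longrightarrow> norm (B k) \<le> K"
    and lim: "(\<lambda>n. (1 / real n) *\<^sub>R (\<Sum>k=1..n. B k)) \<longlonglongrightarrow> m" and T: "0 \<le> T"
  shows "(\<lambda>n. SUP t\<in>{0..T}. norm ((foldr (\<lambda>k P. op_exp ((t / real n) *\<^sub>R B k) o\<^sub>L P) [1..<Suc n] id_blinfun
      - op_exp (t *\<^sub>R m)) x)) \<longlonglongrightarrow> 0"
proof -
  let ?err = "\<lambda>n t. foldr (\<lambda>k P. op_exp ((t / real n) *\<^sub>R B k) o\<^sub>L P) [1..<Suc n] id_blinfun - op_exp (t *\<^sub>R m)"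
  define d where "d n = norm (\<Sum>j=1..n. B j - m)" for n
  define \<delta> where "\<delta> n = Max (d ` {..n})" for n
  define bound where "bound n = T * exp (K * T) ^ 2 * (1 + 2 * K * T * exp (K * T)) * (\<delta> n / real n)
       + 2 * (K * T)\<^sup>2 * exp (K * T) ^ 3 / real n" for n
  have m: "norm m \<le> K"
  proof (rule tendsto_upperbound[OF tendsto_norm[OF lim]])
    have "norm ((1 / real n) *\<^sub>R (\<Sum>k=1..n. B k)) \<le> K" if "1 \<le> n" for n
    proof -
      have "norm (\<Sum>k=1..n. B k) \<le> real n * K"
        using sum_norm_bound[of "{1..n}" B K] B by simp
      then show ?thesis
        using that by (simp add: field_simps)
    qed
    then show "\<forall>\<^sub>F n in sequentially. norm ((1 / real n) *\<^sub>R (\<Sum>k=1..n. B k)) \<le> K"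
      using eventually_sequentially by blast
  qed simp
  have "(\<lambda>n. norm ((1 / real n) *\<^sub>R (\<Sum>k=1..n. B k) - m)) \<longlonglongrightarrow> 0"
    using lim by (intro tendsto_norm_zero) (simp add: LIM_zero)
  then have "(\<lambda>n. d n / real n) \<longlonglongrightarrow> 0"
  proof (rule Lim_transform_eventually)
    have "norm ((1 / real n) *\<^sub>R (\<Sum>k=1..n. B k) - m) = d n / real n" if "1 \<le> n" for n
    proof -
      have "(1 / real n) *\<^sub>R (\<Sum>k=1..n. B k) - m = (1 / real n) *\<^sub>R (\<Sum>j=1..n. B j - m)"
        using that by (simp add: sum_subtractf scaleR_diff_right sum_constant_scaleR)
      then show ?thesis by (simp add: d_def)
    qed
    then show "\<forall>\<^sub>F n in sequentially. norm ((1 / real n) *\<^sub>R (\<Sum>k=1..n. B k) - m) = d n / real n"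
      using eventually_sequentially by blast
  qed
  then have lim\<delta>: "(\<lambda>n. \<delta> n / real n) \<longlonglongrightarrow> 0"
    unfolding \<delta>_def by (rule running_max_over_n_tendsto_0) (simp add: d_def)
  have "bound \<longlonglongrightarrow> T * exp (K * T) ^ 2 * (1 + 2 * K * T * exp (K * T)) * 0 + 0"
    unfolding bound_def by (intro tendsto_intros lim\<delta> lim_const_over_n)
  then have lim_bound: "(\<lambda>n. bound n * norm x) \<longlonglongrightarrow> 0"
    by (auto intro: tendsto_mult_left_zero)
  have err: "norm (?err n t x) \<le> bound n * norm x" if "1 \<le> n" "t \<in> {0..T}" for n t
  proof -
    have "norm (?err n t) \<le> bound n"
      unfolding bound_def using that
      by (intro exp_product_error_le B m) (auto simp: \<delta>_def d_def intro!: Max_ge)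
    then show ?thesis
      by (intro order_trans[OF norm_blinfun] mult_right_mono) auto
  qed
  have "0 \<le> (SUP t\<in>{0..T}. norm (?err n t x)) \<and> (SUP t\<in>{0..T}. norm (?err n t x)) \<le> bound n * norm x"
    if n: "1 \<le> n" for n
  proof
    have "bdd_above ((\<lambda>t. norm (?err n t x)) ` {0..T})"
      using err[OF n] by (intro bdd_aboveI2)
    then show "0 \<le> (SUP t\<in>{0..T}. norm (?err n t x))"
      using T by (intro cSUP_upper2[where x = 0]) auto
    show "(SUP t\<in>{0..T}. norm (?err n t x)) \<le> bound n * norm x"
      using T err[OF n] by (intro cSUP_least) auto
  qed
  then have "\<forall>\<^sub>F n in sequentially. norm (SUP t\<in>{0..T}. norm (?err n t x)) \<le> bound n * norm x"
    unfolding eventually_sequentially by (intro exI[of _ 1]) simp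
  then show ?thesis
    by (rule Lim_null_comparison[OF _ lim_bound])
qed

section \<open>The Bochner expectation of a bounded map\<close>

text \<open>
  In a space that is not second countable, the difference of two Borel measurable maps may fail to be
  measurable. It causes no trouble when one of them has only finitely many values.
\<close>

lemma borel_measurable_norm_diff_simple:
  fixes f :: "'w \<Rightarrow> 'b::real_normed_vector"
  assumes f: "f \<in> borel_measurable M" and s: "simple_function M s"
  shows "(\<lambda>\<omega>. norm (f \<omega> - s \<omega>)) \<in> borel_measurable M"
proof (rule measurable_compose_countable'[where I = "s ` space M" and f = "\<lambda>c \<omega>. norm (f \<omega> - c)" and g = s])
  show "(\<lambda>\<omega>. norm (f \<omega> - c)) \<in> borel_measurable M" for c
    by (rule measurable_compose[OF f])
      (intro borel_measurable_continuous_onI continuous_intros)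
  show "s \<in> measurable M (count_space (s ` space M))"
    using s by (auto simp: simple_function_def measurable_count_space_eq2)
  show "countable (s ` space M)"
    using simple_functionD(1)[OF s] by (rule countable_finite)
qed

text \<open>
  Two simple functions that are close to \<open>f\<close> in mean are close to each other. This single inequality
  yields both the existence and the uniqueness of the Bochner expectation.
\<close>

lemma norm_simple_bochner_integral_diff_le:
  fixes f :: "'w \<Rightarrow> 'b::real_normed_vector"
  assumes f: "f \<in> borel_measurable M"
    and s: "Bochner_Integration.simple_bochner_integrable M s"
    and t: "Bochner_Integration.simple_bochner_integrable M t"
  shows "ennreal (norm (Bochner_Integration.simple_bochner_integral M s
      - Bochner_Integration.simple_bochner_integral M t))
    \<le> (\<integral>\<^sup>+ \<omega>. norm (f \<omega> - s \<omega>) \<partial>M) + (\<integral>\<^sup>+ \<omega>. norm (f \<omega> - t \<omega>) \<partial>M)"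
proof -
  let ?I = "Bochner_Integration.simple_bochner_integral M"
  have simple: "simple_function M s" "simple_function M t"
    using s t by (auto elim: Bochner_Integration.simple_bochner_integrable.cases)
  note [measurable] = simple[THEN borel_measurable_norm_diff_simple[OF f]]
  have st: "Bochner_Integration.simple_bochner_integrable M (\<lambda>\<omega>. s \<omega> - t \<omega>)"
    "Bochner_Integration.simple_bochner_integrable M (\<lambda>\<omega>. norm (s \<omega> - t \<omega>))"
    by (rule Bochner_Integration.simple_bochner_integrable_compose2[OF _ s t], simp)+
  have "ennreal (norm (?I s - ?I t)) = ennreal (norm (?I (\<lambda>\<omega>. s \<omega> - t \<omega>)))"
    by (simp add: Bochner_Integration.simple_bochner_integral_diff[OF s t])
  also have "\<dots> \<le> ennreal (?I (\<lambda>\<omega>. norm (s \<omega> - t \<omega>)))"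
    by (intro ennreal_leI Bochner_Integration.simple_bochner_integral_norm_bound st)
  also have "\<dots> = (\<integral>\<^sup>+ \<omega>. norm (s \<omega> - t \<omega>) \<partial>M)"
    by (rule Bochner_Integration.simple_bochner_integral_eq_nn_integral[OF st(2)]) simp
  also have "\<dots> \<le> (\<integral>\<^sup>+ \<omega>. ennreal (norm (f \<omega> - s \<omega>)) + ennreal (norm (f \<omega> - t \<omega>)) \<partial>M)"
  proof (intro nn_integral_mono)
    fix \<omega>
    have "norm (s \<omega> - t \<omega>) \<le> norm (f \<omega> - s \<omega>) + norm (f \<omega> - t \<omega>)"
      using norm_triangle_ineq4[of "f \<omega> - t \<omega>" "f \<omega> - s \<omega>"] by simp
    then show "ennreal (norm (s \<omega> - t \<omega>)) \<le> ennreal (norm (f \<omega> - s \<omega>)) + ennreal (norm (f \<omega> - t \<omega>))"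
      by (simp flip: ennreal_plus)
  qed
  also have "\<dots> = (\<integral>\<^sup>+ \<omega>. norm (f \<omega> - s \<omega>) \<partial>M) + (\<integral>\<^sup>+ \<omega>. norm (f \<omega> - t \<omega>) \<partial>M)"
    by (rule nn_integral_add) simp_all
  finally show ?thesis .
qed

lemma norm_bochner_expectation_diff_le:
  fixes f :: "'w \<Rightarrow> 'b::real_normed_vector"
  assumes f: "f \<in> borel_measurable M" and m: "has_bochner_expectation M f m"
    and t: "Bochner_Integration.simple_bochner_integrable M t"
  shows "ennreal (norm (m - Bochner_Integration.simple_bochner_integral M t))
    \<le> (\<integral>\<^sup>+ \<omega>. norm (f \<omega> - t \<omega>) \<partial>M)"
proof -
  let ?I = "Bochner_Integration.simple_bochner_integral M"
  obtain s where s: "\<And>i. Bochner_Integration.simple_bochner_integrable M (s i)"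
    and lim0: "(\<lambda>i. \<integral>\<^sup>+ \<omega>. ennreal (norm (f \<omega> - s i \<omega>)) \<partial>M) \<longlonglongrightarrow> 0"
    and limm: "(\<lambda>i. ?I (s i)) \<longlonglongrightarrow> m"
    using m unfolding has_bochner_expectation_def by blast
  show ?thesis
  proof (rule LIMSEQ_le)
    show "(\<lambda>i. ennreal (norm (?I (s i) - ?I t))) \<longlonglongrightarrow> ennreal (norm (m - ?I t))"
      by (intro tendsto_intros tendsto_ennrealI limm)
    show "(\<lambda>i. (\<integral>\<^sup>+ \<omega>. norm (f \<omega> - s i \<omega>) \<partial>M) + (\<integral>\<^sup>+ \<omega>. norm (f \<omega> - t \<omega>) \<partial>M))
        \<longlonglongrightarrow> (\<integral>\<^sup>+ \<omega>. norm (f \<omega> - t \<omega>) \<partial>M)"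
      using tendsto_add[OF lim0 tendsto_const] by simp
    show "\<exists>N. \<forall>i\<ge>N. ennreal (norm (?I (s i) - ?I t))
        \<le> (\<integral>\<^sup>+ \<omega>. norm (f \<omega> - s i \<omega>) \<partial>M) + (\<integral>\<^sup>+ \<omega>. norm (f \<omega> - t \<omega>) \<partial>M)"
      using norm_simple_bochner_integral_diff_le[OF f s t] by blast
  qed
qed

lemma has_bochner_expectation_unique:
  fixes f :: "'w \<Rightarrow> 'b::real_normed_vector"
  assumes f: "f \<in> borel_measurable M" and m: "has_bochner_expectation M f m"
    and m': "has_bochner_expectation M f m'"
  shows "m = m'"
proof -
  let ?I = "Bochner_Integration.simple_bochner_integral M"
  obtain s where s: "\<And>i. Bochner_Integration.simple_bochner_integrable M (s i)"
    and lim0: "(\<lambda>i. \<integral>\<^sup>+ \<omega>. ennreal (norm (f \<omega> - s i \<omega>)) \<partial>M) \<longlonglongrightarrow> 0"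
    and limm: "(\<lambda>i. ?I (s i)) \<longlonglongrightarrow> m'"
    using m' unfolding has_bochner_expectation_def by blast
  have "(\<lambda>i. ennreal (norm (m - ?I (s i)))) \<longlonglongrightarrow> 0"
    using norm_bochner_expectation_diff_le[OF f m s]
    by (intro tendsto_sandwich[OF _ _ tendsto_const lim0]) auto
  moreover have "(\<lambda>i. ennreal (norm (m - ?I (s i)))) \<longlonglongrightarrow> ennreal (norm (m - m'))"
    by (intro tendsto_intros tendsto_ennrealI limm)
  ultimately have "ennreal (norm (m - m')) = 0"
    using LIMSEQ_unique by blast
  then show ?thesis by simp
qed

lemma bochner_expectation_eqI:
  fixes f :: "'w \<Rightarrow> 'b::real_normed_vector"
  assumes "f \<in> borel_measurable M" "has_bochner_expectation M f m"
  shows "bochner_expectation M f = m"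
  unfolding bochner_expectation_def
proof (rule the_equality)
  show "has_bochner_expectation M f m"
    by (rule assms(2))
  show "m' = m" if "has_bochner_expectation M f m'" for m'
    by (rule has_bochner_expectation_unique[OF assms(1) that assms(2)])
qed

text \<open>
  The map \<open>\<phi>\<close> rounds the values of \<open>f\<close> to finitely many points with error below \<open>\<epsilon>\<close>, except on the event
  \<open>f \<notin> U\<close> of probability below \<open>\<epsilon>\<close>. The rounding acts on the values rather than on the sample space, so
  that one \<open>\<phi>\<close> serves all members of an identically distributed sequence. The value \<open>0\<close> outside
  \<open>U\<close> makes the error there the norm of the point, which is bounded in the applications.
\<close>

definition quantizes :: "'w measure \<Rightarrow> ('w \<Rightarrow> 'b::real_normed_vector) \<Rightarrow> real \<Rightarrow> ('b \<Rightarrow> 'b) \<Rightarrow> 'b set \<Rightarrow> bool"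
  where "quantizes M f \<epsilon> \<phi> U \<longleftrightarrow> simple_function borel \<phi> \<and> U \<in> sets borel \<and>
    (\<forall>y\<in>U. norm (y - \<phi> y) < \<epsilon>) \<and> (\<forall>y. y \<notin> U \<longrightarrow> \<phi> y = 0) \<and>
    measure M {\<omega>\<in>space M. f \<omega> \<notin> U} < \<epsilon>"

lemma finite_cover_quantizer:
  fixes C :: "'b::real_normed_vector set"
  assumes "finite C"
  shows "\<exists>\<phi>. simple_function borel \<phi> \<and> (\<forall>y\<in>(\<Union>c\<in>C. ball c \<epsilon>). norm (y - \<phi> y) < \<epsilon>) \<and>
    (\<forall>y. y \<notin> (\<Union>c\<in>C. ball c \<epsilon>) \<longrightarrow> \<phi> y = 0)"
  using assms
proof (induction C rule: finite_induct)
  case empty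
  show ?case by (rule exI[of _ "\<lambda>_. 0"]) simp
next
  case (insert c C)
  then obtain \<phi> where \<phi>: "simple_function borel \<phi>"
    "\<forall>y\<in>(\<Union>c\<in>C. ball c \<epsilon>). norm (y - \<phi> y) < \<epsilon>" "\<forall>y. y \<notin> (\<Union>c\<in>C. ball c \<epsilon>) \<longrightarrow> \<phi> y = 0"
    by blast
  have "simple_function borel (\<lambda>y. if y \<in> ball c \<epsilon> then c else \<phi> y)"
    by (intro simple_function_If_set \<phi>) auto
  moreover have "norm (y - c) < \<epsilon>" if "y \<in> ball c \<epsilon>" for y
    using that by (simp add: dist_norm norm_minus_commute)
  ultimately show ?case
    using \<phi> by (intro exI[of _ "\<lambda>y. if y \<in> ball c \<epsilon> then c else \<phi> y"]) auto
qed

text \<open>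
  Almost every value of \<open>f\<close> is a limit of values of the approximating simple functions. Hence the
  \<open>\<epsilon>\<close>-balls around these countably many values cover almost all of the distribution of \<open>f\<close>, and by
  continuity of the measure finitely many of them cover all but \<open>\<epsilon>\<close> of it.
\<close>

lemma quantizer_exists:
  fixes f :: "'w \<Rightarrow> 'b::real_normed_vector"
  assumes M: "prob_space M" and f: "f \<in> borel_measurable M" and bm: "bochner_measurable M f" and \<epsilon>: "0 < \<epsilon>"
  obtains \<phi> U where "quantizes M f \<epsilon> \<phi> U"
proof -
  interpret prob_space M by (rule M)
  obtain s where s: "\<And>i. simple_function M (s i)" and lim: "AE \<omega> in M. (\<lambda>i. s i \<omega>) \<longlonglongrightarrow> f \<omega>"
    using bm unfolding bochner_measurable_def by blast
  define C where "C n = (\<Union>i<n. s i ` space M)" for n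
  define V where "V n = (\<Union>c\<in>C n. ball c \<epsilon>)" for n
  define Z where "Z n = {\<omega>\<in>space M. f \<omega> \<notin> V n}" for n
  have finC: "finite (C n)" for n
    unfolding C_def using s by (auto simp: simple_functionD(1))
  have openV: "open (V n)" for n
    unfolding V_def by auto
  have Z_sets: "Z n \<in> sets M" for n
  proof -
    have "Z n = f -` (- V n) \<inter> space M"
      by (auto simp: Z_def)
    then show ?thesis
      using measurable_sets[OF f, of "- V n"] openV[of n] by auto
  qed
  have "decseq Z"
    unfolding decseq_def Z_def V_def C_def by (auto 4 3 intro: order_less_le_trans)
  then have limZ: "(\<lambda>n. prob (Z n)) \<longlonglongrightarrow> prob (\<Inter>n. Z n)"
    using Z_sets by (intro finite_Lim_measure_decseq) auto
  have "AE \<omega> in M. \<omega> \<notin> (\<Inter>n. Z n)"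
    using lim AE_space
  proof eventually_elim
    case (elim \<omega>)
    then obtain i where "norm (s i \<omega> - f \<omega>) < \<epsilon>"
      using LIMSEQ_D[OF elim(1) \<epsilon>] by blast
    then have "f \<omega> \<in> ball (s i \<omega>) \<epsilon>"
      by (simp add: dist_norm)
    moreover have "s i \<omega> \<in> C (Suc i)"
      using elim(2) by (auto simp: C_def)
    ultimately have "\<omega> \<notin> Z (Suc i)"
      unfolding Z_def V_def by auto
    then show ?case by blast
  qed
  then have "prob (\<Inter>n. Z n) = 0"
    using Z_sets by (subst prob_eq_0) auto
  then obtain n where n: "prob (Z n) < \<epsilon>"
    using limZ \<epsilon> order_tendstoD(2)[OF limZ, of \<epsilon>] eventually_happens'[OF sequentially_bot] by auto
  obtain \<phi> where "simple_function borel \<phi>" "\<forall>y\<in>V n. norm (y - \<phi> y) < \<epsilon>" "\<forall>y. y \<notin> V n \<longrightarrow> \<phi> y = 0"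
    using finite_cover_quantizer[OF finC] unfolding V_def by blast
  then have "quantizes M f \<epsilon> \<phi> (V n)"
    unfolding quantizes_def using n openV by (auto simp: Z_def)
  then show ?thesis by (rule that)
qed

lemma quantizer_error_pointwise:
  assumes "quantizes M f \<epsilon> \<phi> U" "0 < \<epsilon>" "norm y \<le> K"
  shows "norm (y - \<phi> y) \<le> \<epsilon> + K * indicator (- U) y"
proof (cases "y \<in> U")
  case True
  then have "norm (y - \<phi> y) < \<epsilon>"
    using assms(1) by (simp add: quantizes_def)
  then show ?thesis
    using True by simp
next
  case False
  then have "\<phi> y = 0"
    using assms(1) by (simp add: quantizes_def)
  then show ?thesis
    using False assms(2,3) by simp
qed

lemma quantizer_L1_error:
  fixes f :: "'w \<Rightarrow> 'b::real_normed_vector"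
  assumes M: "prob_space M" and f: "f \<in> borel_measurable M" and K: "AE \<omega> in M. norm (f \<omega>) \<le> K" "0 \<le> K"
    and q: "quantizes M f \<epsilon> \<phi> U" and \<epsilon>: "0 < \<epsilon>"
  shows "(\<integral>\<^sup>+ \<omega>. norm (f \<omega> - \<phi> (f \<omega>)) \<partial>M) \<le> ennreal ((1 + K) * \<epsilon>)"
proof -
  interpret prob_space M by (rule M)
  have [measurable]: "U \<in> sets borel" and small: "prob {\<omega>\<in>space M. f \<omega> \<notin> U} < \<epsilon>"
    using q by (auto simp: quantizes_def)
  note f[measurable]
  have "(\<integral>\<^sup>+ \<omega>. norm (f \<omega> - \<phi> (f \<omega>)) \<partial>M)
      \<le> (\<integral>\<^sup>+ \<omega>. ennreal \<epsilon> + ennreal K * indicator {\<omega>\<in>space M. f \<omega> \<notin> U} \<omega> \<partial>M)"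
  proof (rule nn_integral_mono_AE, use K(1) AE_space in eventually_elim)
    case (elim \<omega>)
    have "ennreal (norm (f \<omega> - \<phi> (f \<omega>))) \<le> ennreal (\<epsilon> + K * indicator (- U) (f \<omega>))"
      by (intro ennreal_leI quantizer_error_pointwise[OF q \<epsilon>] elim)
    then show ?case
      using elim K \<epsilon> by (auto simp: indicator_def ennreal_plus split: if_splits)
  qed
  also have "\<dots> = ennreal \<epsilon> + ennreal K * emeasure M {\<omega>\<in>space M. f \<omega> \<notin> U}"
    by (subst nn_integral_add) (auto simp: nn_integral_cmult emeasure_space_1)
  also have "\<dots> \<le> ennreal \<epsilon> + ennreal K * ennreal \<epsilon>"
    using small by (intro add_left_mono mult_left_mono) (auto simp: emeasure_eq_measure intro!: ennreal_leI)
  also have "\<dots> = ennreal ((1 + K) * \<epsilon>)"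
    using K \<epsilon> by (simp add: ennreal_mult distrib_right)
  finally show ?thesis .
qed

lemma quantizer_simple_integrable:
  fixes f :: "'w \<Rightarrow> 'b::real_normed_vector"
  assumes M: "prob_space M" and f: "f \<in> borel_measurable M" and q: "quantizes M f \<epsilon> \<phi> U"
  shows "Bochner_Integration.simple_bochner_integrable M (\<lambda>\<omega>. \<phi> (f \<omega>))"
proof -
  interpret prob_space M by (rule M)
  have "simple_function M (\<lambda>\<omega>. \<phi> (f \<omega>))"
    using q by (intro simple_function_comp[OF f]) (simp add: quantizes_def)
  then show ?thesis
    by (rule Bochner_Integration.simple_bochner_integrable.intros) simp
qed

text \<open>
  The rounded functions with \<open>\<epsilon> \<rightarrow> 0\<close> approximate \<open>f\<close> in mean, so their integrals form a Cauchy sequence.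
\<close>

lemma has_bochner_expectation_bounded:
  fixes f :: "'w \<Rightarrow> 'b::banach"
  assumes M: "prob_space M" and f: "f \<in> borel_measurable M" and bm: "bochner_measurable M f"
    and K: "AE \<omega> in M. norm (f \<omega>) \<le> K" "0 \<le> K"
  obtains m where "has_bochner_expectation M f m"
proof -
  let ?I = "Bochner_Integration.simple_bochner_integral M"
  define e where "e i = 1 / real (Suc i)" for i
  have e: "0 < e i" for i by (simp add: e_def)
  have "\<exists>\<phi> U. quantizes M f (e i) \<phi> U" for i
    using quantizer_exists[OF M f bm e] by blast
  then obtain \<phi> U where q: "\<And>i. quantizes M f (e i) (\<phi> i) (U i)"
    by metis
  define s where "s i \<omega> = \<phi> i (f \<omega>)" for i \<omega>
  have s: "Bochner_Integration.simple_bochner_integrable M (s i)" for i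
    unfolding s_def by (rule quantizer_simple_integrable[OF M f q])
  have err: "(\<integral>\<^sup>+ \<omega>. norm (f \<omega> - s i \<omega>) \<partial>M) \<le> ennreal ((1 + K) * e i)" for i
    unfolding s_def by (rule quantizer_L1_error[OF M f K q e])
  have elim: "(\<lambda>i. (1 + K) * e i) \<longlonglongrightarrow> 0"
    using tendsto_mult[OF tendsto_const LIMSEQ_Suc[OF lim_1_over_n]] by (simp add: e_def)
  have dist: "norm (?I (s i) - ?I (s j)) \<le> (1 + K) * e i + (1 + K) * e j" for i j
  proof -
    have "ennreal (norm (?I (s i) - ?I (s j))) \<le> ennreal ((1 + K) * e i) + ennreal ((1 + K) * e j)"
      by (rule order_trans[OF norm_simple_bochner_integral_diff_le[OF f s s] add_mono[OF err err]])
    also have "\<dots> = ennreal ((1 + K) * e i + (1 + K) * e j)"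
      using K e[THEN less_imp_le] by (simp add: ennreal_plus)
    finally show ?thesis
      using K e[THEN less_imp_le] by (subst (asm) ennreal_le_iff) auto
  qed
  have "Cauchy (\<lambda>i. ?I (s i))"
  proof (rule CauchyI)
    fix r :: real assume "0 < r"
    then obtain N where N: "\<And>i. i \<ge> N \<Longrightarrow> (1 + K) * e i < r / 2"
      using order_tendstoD(2)[OF elim, of "r / 2"] by (auto simp: eventually_sequentially)
    show "\<exists>N. \<forall>i\<ge>N. \<forall>j\<ge>N. norm (?I (s i) - ?I (s j)) < r"
    proof (intro exI[of _ N] allI impI)
      fix i j assume "N \<le> i" "N \<le> j"
      then show "norm (?I (s i) - ?I (s j)) < r"
        using dist[of i j] N[of i] N[of j] by linarith
    qed
  qed
  then obtain m where m: "(\<lambda>i. ?I (s i)) \<longlonglongrightarrow> m"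
    using Cauchy_convergent convergentD by blast
  have lim': "(\<lambda>i. ennreal ((1 + K) * e i)) \<longlonglongrightarrow> 0"
    using tendsto_ennrealI[OF elim] by simp
  have "(\<lambda>i. \<integral>\<^sup>+ \<omega>. ennreal (norm (f \<omega> - s i \<omega>)) \<partial>M) \<longlonglongrightarrow> 0"
    by (rule tendsto_sandwich[OF always_eventually always_eventually tendsto_const lim'])
      (intro allI zero_le err)+
  then have "has_bochner_expectation M f m"
    unfolding has_bochner_expectation_def using bm s m by (intro conjI exI[of _ s] allI)
  then show ?thesis by (rule that)
qed

section \<open>The strong law of large numbers\<close>

text \<open>
  By Hoeffding's inequality, the probability that the frequency up to time \<open>n\<close> is off by at least \<open>\<epsilon>\<close> is at
  most \<open>2 e\<^bsup>-2n\<epsilon>\<^sup>2\<^esup>\<close>. This is summable in \<open>n\<close>, so almost surely it happens only finitely often.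
\<close>

lemma strong_law_frequencies:
  fixes X :: "nat \<Rightarrow> 'w \<Rightarrow> 'b::topological_space"
  assumes M: "prob_space M" and X: "iid M X" and B: "B \<in> sets borel"
  shows "AE \<omega> in M. (\<lambda>n. (\<Sum>k=1..n. indicator B (X k \<omega>)) / real n)
    \<longlonglongrightarrow> measure M {\<omega>\<in>space M. X 0 \<omega> \<in> B}"
proof -
  interpret prob_space M by (rule M)
  define Y where "Y k \<omega> = (indicator B (X k \<omega>) :: real)" for k \<omega>
  define p where "p = prob {\<omega>\<in>space M. X 0 \<omega> \<in> B}"
  define dev where "dev n \<omega> = \<bar>(\<Sum>k=1..n. Y k \<omega>) / real n - p\<bar>" for n \<omega>
  have ind: "indep_vars (\<lambda>_. borel) X UNIV" and distr: "\<And>i. distr M borel (X i) = distr M borel (X 0)"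
    using X unfolding iid_def by blast+
  have X_meas [measurable]: "X k \<in> borel_measurable M" for k
    using ind unfolding indep_vars_def by auto
  note B[measurable]
  have Y_meas [measurable]: "Y k \<in> borel_measurable M" for k
    unfolding Y_def by measurable
  have indY: "indep_vars (\<lambda>_. borel) Y UNIV"
    unfolding Y_def by (rule indep_vars_compose2[OF ind]) measurable
  have distrY: "distr M borel (Y k) = distr M borel (Y 0)" for k
  proof -
    have "distr M borel (Y i) = distr (distr M borel (X i)) borel (indicator B)" for i
      unfolding Y_def by (subst distr_distr) (auto simp: comp_def)
    then show ?thesis using distr by metis
  qed
  have EY: "expectation (Y 0) = p"
  proof -
    have "expectation (Y 0) = expectation (indicator {\<omega>\<in>space M. X 0 \<omega> \<in> B})"
      by (intro Bochner_Integration.integral_cong) (auto simp: Y_def indicator_def)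
    then show ?thesis
      by (simp add: p_def)
  qed
  have hoeffding: "prob {\<omega>\<in>space M. dev n \<omega> \<ge> \<epsilon>} \<le> 2 * exp (- 2 * real n * \<epsilon>\<^sup>2)"
    if n: "1 \<le> n" and \<epsilon>: "0 \<le> \<epsilon>" for n \<epsilon>
  proof -
    interpret Hoeffding_ineq_iid M "{1..n}" Y "Y 0" 0 1 p
    proof unfold_locales
      show "indep_vars (\<lambda>_. borel) Y {1..n}"
        by (rule indep_vars_subset[OF indY]) simp
      show "distr M borel (Y k) = distr M borel (Y 0)" for k
        by (rule distrY)
      show "AE \<omega> in M. Y 0 \<omega> \<in> {0..1}"
        by (simp add: Y_def indicator_def)
      show "p \<equiv> expectation (Y 0)"
        by (simp add: EY)
    qed simp_all
    show ?thesis
      using Hoeffding_ineq_abs_ge'[OF \<epsilon>] n by (simp add: dev_def)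
  qed
  have ev: "AE \<omega> in M. \<forall>\<^sub>F n in sequentially. dev n \<omega> < \<epsilon>" if \<epsilon>: "0 < \<epsilon>" for \<epsilon>
  proof -
    define Bad where "Bad n = {\<omega>\<in>space M. dev n \<omega> \<ge> \<epsilon>}" for n
    have [measurable]: "dev n \<in> borel_measurable M" for n
      unfolding dev_def by measurable
    have Bad_sets: "Bad n \<in> sets M" for n
      unfolding Bad_def by measurable
    have "summable (\<lambda>n. prob (Bad n))"
    proof (rule summable_comparison_test_ev)
      have "exp (- 2 * \<epsilon>\<^sup>2) < 1"
        using \<epsilon> by simp
      then have "summable (\<lambda>n. 2 * exp (- 2 * \<epsilon>\<^sup>2) ^ n)"
        by (intro summable_mult summable_geometric) simp
      then show "summable (\<lambda>n. 2 * exp (- 2 * real n * \<epsilon>\<^sup>2))"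
        by (simp add: mult_ac flip: exp_of_nat_mult)
      have "norm (prob (Bad n)) \<le> 2 * exp (- 2 * real n * \<epsilon>\<^sup>2)" if "1 \<le> n" for n
        using hoeffding[OF that, of \<epsilon>] \<epsilon> by (simp add: Bad_def)
      then show "\<forall>\<^sub>F n in sequentially. norm (prob (Bad n)) \<le> 2 * exp (- 2 * real n * \<epsilon>\<^sup>2)"
        using eventually_sequentially by blast
    qed
    then have "AE \<omega> in M. \<forall>\<^sub>F n in sequentially. \<omega> \<in> space M - Bad n"
      by (intro borel_cantelli_AE1 Bad_sets) (simp_all add: emeasure_eq_measure)
    then show ?thesis
      by eventually_elim (auto simp: Bad_def elim!: eventually_mono)
  qed
  \<comment> \<open>The null set depends on \<open>\<epsilon>\<close>, so \<open>\<epsilon>\<close> is restricted to a sequence before the quantifiers are swapped.\<close>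
  have "AE \<omega> in M. \<forall>j. \<forall>\<^sub>F n in sequentially. dev n \<omega> < 1 / real (Suc j)"
    by (subst AE_all_countable) (intro allI ev, simp)
  then show ?thesis
  proof eventually_elim
    case (elim \<omega>)
    show ?case
    proof (rule tendstoI)
      fix e :: real assume "0 < e"
      then obtain j where j: "1 / real (Suc j) < e"
        using nat_approx_posE by blast
      have "\<forall>\<^sub>F n in sequentially. dev n \<omega> < 1 / real (Suc j)"
        using elim by blast
      then show "\<forall>\<^sub>F n in sequentially. dist ((\<Sum>k=1..n. indicator B (X k \<omega>)) / real n)
          (measure M {\<omega>\<in>space M. X 0 \<omega> \<in> B}) < e"
        by eventually_elim (use j in \<open>simp add: dev_def Y_def p_def dist_real_def\<close>)
    qed
  qed
qed

lemma iid_AE_transfer: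
  assumes "iid M X" "\<And>i. X i \<in> borel_measurable M"
    "B \<in> sets borel" "AE \<omega> in M. X 0 \<omega> \<in> B"
  shows "AE \<omega> in M. X i \<omega> \<in> B"
proof -
  have "AE y in distr M borel (X 0). y \<in> B"
    using assms by (subst AE_distr_iff) auto
  then have "AE y in distr M borel (X i). y \<in> B"
    using assms(1) unfolding iid_def by metis
  then show ?thesis
    using assms by (subst (asm) AE_distr_iff) auto
qed

text \<open>
  Rounding with a fixed \<open>\<epsilon>\<close> costs at most \<open>(1 + K) \<epsilon>\<close> in the expectation, and asymptotically at most
  \<open>(1 + K) \<epsilon>\<close> in the averages, because the exceptional set is visited with frequency below \<open>\<epsilon>\<close>. The
  averages of the rounded variables are linear combinations of finitely many frequencies. Letting \<open>\<epsilon>\<close>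
  run through \<open>1/(j + 1)\<close> keeps the exceptional null sets countable in number.
\<close>

lemma strong_law_bounded_bochner:
  fixes X :: "nat \<Rightarrow> 'w \<Rightarrow> 'b::banach"
  assumes M: "prob_space M" and X: "iid M X" and bm: "bochner_measurable M (X 0)"
    and K: "AE \<omega> in M. norm (X 0 \<omega>) \<le> K" "0 \<le> K"
    and m: "has_bochner_expectation M (X 0) m"
  shows "AE \<omega> in M. (\<lambda>n. (1 / real n) *\<^sub>R (\<Sum>k=1..n. X k \<omega>)) \<longlonglongrightarrow> m"
proof -
  interpret prob_space M by (rule M)
  let ?I = "Bochner_Integration.simple_bochner_integral M"
  have X_meas: "X k \<in> borel_measurable M" for k
    using X unfolding iid_def indep_vars_def by auto
  have bounded: "AE \<omega> in M. \<forall>k. norm (X k \<omega>) \<le> K"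
  proof (subst AE_all_countable, intro allI)
    fix k
    have "AE \<omega> in M. X k \<omega> \<in> cball 0 K"
      by (rule iid_AE_transfer[OF X X_meas]) (use K in auto)
    then show "AE \<omega> in M. norm (X k \<omega>) \<le> K" by simp
  qed
  \<comment> \<open>The constant is the sum of the two rounding errors \<open>(1 + K) \<epsilon>\<close> and of \<open>\<epsilon>\<close> for the distance of the
    averages of the rounded variables from their limit.\<close>
  have close: "AE \<omega> in M. \<forall>\<^sub>F n in sequentially.
      norm ((1 / real n) *\<^sub>R (\<Sum>k=1..n. X k \<omega>) - m) < (3 + 2 * K) * \<epsilon>" if \<epsilon>: "0 < \<epsilon>" for \<epsilon>
  proof -
    obtain \<phi> U where q: "quantizes M (X 0) \<epsilon> \<phi> U"
      using quantizer_exists[OF M X_meas bm \<epsilon>] by blast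
    have U: "U \<in> sets borel" and sf: "simple_function borel \<phi>"
      and small: "prob {\<omega>\<in>space M. X 0 \<omega> \<notin> U} < \<epsilon>"
      using q by (auto simp: quantizes_def)
    define J where "J = ?I (\<lambda>\<omega>. \<phi> (X 0 \<omega>))"
    have fin: "finite (range \<phi>)"
      using simple_functionD(1)[OF sf] by simp
    have level: "\<phi> -` {c} \<in> sets borel" for c
      using simple_functionD(2)[OF sf, of "{c}"] by simp
    have mJ: "norm (m - J) \<le> (1 + K) * \<epsilon>"
    proof -
      have "ennreal (norm (m - J)) \<le> ennreal ((1 + K) * \<epsilon>)"
        unfolding J_def
        by (rule order_trans[OF norm_bochner_expectation_diff_le[OF X_meas m
                quantizer_simple_integrable[OF M X_meas q]] quantizer_L1_error[OF M X_meas K q \<epsilon>]])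
      then show ?thesis
        using K \<epsilon> by (subst (asm) ennreal_le_iff) auto
    qed
    \<comment> \<open>Summing over the whole range of \<open>\<phi>\<close> only adds values of probability zero, and makes the index set
      the same for all variables.\<close>
    have J_eq: "J = (\<Sum>c\<in>range \<phi>. prob {\<omega>\<in>space M. X 0 \<omega> \<in> \<phi> -` {c}} *\<^sub>R c)"
      unfolding J_def Bochner_Integration.simple_bochner_integral_def vimage_singleton_eq
    proof (rule sum.mono_neutral_left[OF fin])
      show "\<forall>c\<in>range \<phi> - (\<lambda>\<omega>. \<phi> (X 0 \<omega>)) ` space M. prob {\<omega>\<in>space M. \<phi> (X 0 \<omega>) = c} *\<^sub>R c = 0"
      proof
        fix c assume "c \<in> range \<phi> - (\<lambda>\<omega>. \<phi> (X 0 \<omega>)) ` space M"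
        then have "{\<omega>\<in>space M. \<phi> (X 0 \<omega>) = c} = {}" by blast
        then show "prob {\<omega>\<in>space M. \<phi> (X 0 \<omega>) = c} *\<^sub>R c = 0" by (simp only: measure_empty scaleR_zero_left)
      qed
    qed auto
    have lvl: "AE \<omega> in M. \<forall>c\<in>range \<phi>. (\<lambda>n. (\<Sum>k=1..n. indicator (\<phi> -` {c}) (X k \<omega>)) / real n)
        \<longlonglongrightarrow> prob {\<omega>\<in>space M. X 0 \<omega> \<in> \<phi> -` {c}}"
      using strong_law_frequencies[OF M X level] fin by (subst AE_finite_all) auto
    have tail: "AE \<omega> in M. (\<lambda>n. (\<Sum>k=1..n. indicator (- U) (X k \<omega>)) / real n)
        \<longlonglongrightarrow> prob {\<omega>\<in>space M. X 0 \<omega> \<in> - U}"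
      using U by (intro strong_law_frequencies[OF M X]) simp
    show ?thesis
      using lvl tail bounded
    proof eventually_elim
      case (elim \<omega>)
      let ?h = "\<lambda>n. (\<Sum>k=1..n. indicator (- U) (X k \<omega>)) / real n"
      let ?avg = "\<lambda>n. (1 / real n) *\<^sub>R (\<Sum>k=1..n. \<phi> (X k \<omega>))"
      have "(\<lambda>n. \<Sum>c\<in>range \<phi>. ((\<Sum>k=1..n. indicator (\<phi> -` {c}) (X k \<omega>)) / real n) *\<^sub>R c) \<longlonglongrightarrow> J"
        unfolding J_eq using elim(1) by (intro tendsto_intros) auto
      moreover have "(\<Sum>c\<in>range \<phi>. ((\<Sum>k=1..n. indicator (\<phi> -` {c}) (X k \<omega>)) / real n) *\<^sub>R c) = ?avg n" for n
      proof -
        have level_sum: "\<phi> y = (\<Sum>c\<in>range \<phi>. indicator (\<phi> -` {c}) y *\<^sub>R c)" for y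
        proof -
          have "(\<Sum>c\<in>range \<phi>. indicator (\<phi> -` {c}) y *\<^sub>R c) = (\<Sum>c\<in>range \<phi>. if c = \<phi> y then c else 0)"
            by (rule sum.cong) (auto simp: indicator_def)
          then show ?thesis using fin by (simp add: sum.delta')
        qed
        have "?avg n = (1 / real n) *\<^sub>R (\<Sum>k=1..n. \<Sum>c\<in>range \<phi>. indicator (\<phi> -` {c}) (X k \<omega>) *\<^sub>R c)"
          by (rule arg_cong[where f = "(*\<^sub>R) (1 / real n)"]) (rule sum.cong[OF refl level_sum])
        also have "\<dots> = (1 / real n) *\<^sub>R (\<Sum>c\<in>range \<phi>. (\<Sum>k=1..n. indicator (\<phi> -` {c}) (X k \<omega>)) *\<^sub>R c)"
          by (subst sum.swap) (simp add: scaleR_left.sum)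
        also have "\<dots> = (\<Sum>c\<in>range \<phi>. ((\<Sum>k=1..n. indicator (\<phi> -` {c}) (X k \<omega>)) / real n) *\<^sub>R c)"
          by (simp add: scaleR_sum_right)
        finally show ?thesis ..
      qed
      ultimately have "?avg \<longlonglongrightarrow> J" by simp
      then have ev1: "\<forall>\<^sub>F n in sequentially. norm (?avg n - J) < \<epsilon>"
        using \<epsilon> by (auto dest: tendstoD simp: dist_norm)
      have "prob {\<omega>\<in>space M. X 0 \<omega> \<in> - U} < \<epsilon>"
        using small by simp
      then have ev2: "\<forall>\<^sub>F n in sequentially. ?h n < \<epsilon>"
        using elim(2) order_tendstoD(2) by blast
      show ?case
        using ev1 ev2 eventually_gt_at_top[of 0]
      proof eventually_elim
        case (elim n)
        have "norm ((1 / real n) *\<^sub>R (\<Sum>k=1..n. X k \<omega>) - ?avg n)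
            = (1 / real n) * norm (\<Sum>k=1..n. X k \<omega> - \<phi> (X k \<omega>))"
          by (simp add: sum_subtractf flip: scaleR_diff_right)
        also have "\<dots> \<le> (1 / real n) * (\<Sum>k=1..n. \<epsilon> + K * indicator (- U) (X k \<omega>))"
          using \<open>\<forall>k. norm (X k \<omega>) \<le> K\<close>
          by (intro mult_left_mono sum_norm_le quantizer_error_pointwise[OF q \<epsilon>]) auto
        also have "\<dots> = \<epsilon> + K * ?h n"
          using elim(3) by (simp add: sum.distrib field_simps flip: sum_distrib_left)
        also have "\<dots> \<le> \<epsilon> + K * \<epsilon>"
          using K elim(2) by (intro add_left_mono mult_left_mono) auto
        finally have "norm ((1 / real n) *\<^sub>R (\<Sum>k=1..n. X k \<omega>) - ?avg n) \<le> \<epsilon> + K * \<epsilon>" .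
        moreover have "norm ((1 / real n) *\<^sub>R (\<Sum>k=1..n. X k \<omega>) - m)
            \<le> norm ((1 / real n) *\<^sub>R (\<Sum>k=1..n. X k \<omega>) - ?avg n) + norm (?avg n - J) + norm (m - J)"
          using norm_triangle_ineq[of "(1 / real n) *\<^sub>R (\<Sum>k=1..n. X k \<omega>) - ?avg n" "?avg n - m"]
            norm_triangle_ineq4[of "?avg n - J" "m - J"] by simp
        ultimately show ?case
          using mJ elim(1) by (simp add: algebra_simps)
      qed
    qed
  qed
  have "AE \<omega> in M. \<forall>j. \<forall>\<^sub>F n in sequentially.
      norm ((1 / real n) *\<^sub>R (\<Sum>k=1..n. X k \<omega>) - m) < (3 + 2 * K) * (1 / real (Suc j))"
    by (subst AE_all_countable) (intro allI close, simp)
  then show ?thesis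
  proof eventually_elim
    case (elim \<omega>)
    show ?case
    proof (rule tendstoI)
      fix e :: real assume "0 < e"
      then obtain j where "1 / real (Suc j) < e / (3 + 2 * K)"
        using nat_approx_posE[of "e / (3 + 2 * K)"] K by auto
      then have j: "(3 + 2 * K) * (1 / real (Suc j)) < e"
        using K by (simp add: pos_less_divide_eq mult.commute)
      show "\<forall>\<^sub>F n in sequentially. dist ((1 / real n) *\<^sub>R (\<Sum>k=1..n. X k \<omega>)) m < e"
        using elim[rule_format, of j] by eventually_elim (use j in \<open>simp add: dist_norm\<close>)
    qed
  qed
qed

section \<open>Random products of exponentials\<close>

theorem theorem2p4:
  fixes M :: "'w measure"
    and smul :: "'k::real_normed_field \<Rightarrow> 'a::banach \<Rightarrow> 'a"
    and A :: "nat \<Rightarrow> 'w \<Rightarrow> ('a \<Rightarrow>\<^sub>L 'a)"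
    and x :: 'a and T :: real
  assumes "prob_space M" and "complete_measure M"
    and "normed_space_over smul"
    and "uniformly_smooth TYPE('a)"
    and "\<And>i. random_operator M smul (A i)"
    and "\<exists>K. AE \<omega> in M. norm (A 0 \<omega>) \<le> K"
    and "iid M A"
    and "T > 0"
  shows "AE \<omega> in M. (\<lambda>n. SUP t\<in>{0..T}.
      norm ((exp_product A n t \<omega> - op_exp (t *\<^sub>R bochner_expectation M (A 0))) x)) \<longlonglongrightarrow> 0"
proof -
  interpret prob_space M by (rule assms(1))
  have A_meas: "A k \<in> borel_measurable M" for k
    using assms(7) unfolding iid_def indep_vars_def by auto
  have bm: "bochner_measurable M (A 0)"
    using assms(5) unfolding random_operator_def by blast
  obtain K0 where "AE \<omega> in M. norm (A 0 \<omega>) \<le> K0"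
    using assms(6) by blast
  then have K: "AE \<omega> in M. norm (A 0 \<omega>) \<le> max K0 0"
    by eventually_elim simp
  define m where "m = bochner_expectation M (A 0)"
  obtain m' where "has_bochner_expectation M (A 0) m'"
    using has_bochner_expectation_bounded[OF assms(1) A_meas bm K] by auto
  then have m: "has_bochner_expectation M (A 0) m"
    unfolding m_def using bochner_expectation_eqI[OF A_meas] by metis
  \<comment> \<open>The bound is a property of the common distribution, so it holds for all indices at once.\<close>
  have "AE \<omega> in M. \<forall>k. A k \<omega> \<in> cball 0 (max K0 0)"
    using iid_AE_transfer[OF assms(7) A_meas, of "cball 0 (max K0 0)"] K
    by (subst AE_all_countable) auto
  moreover have "AE \<omega> in M. (\<lambda>n. (1 / real n) *\<^sub>R (\<Sum>k=1..n. A k \<omega>)) \<longlonglongrightarrow> m"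
    by (rule strong_law_bounded_bochner[OF assms(1,7) bm K _ m]) simp
  ultimately show ?thesis
  proof eventually_elim
    case (elim \<omega>)
    then show ?case
      unfolding exp_product_def m_def[symmetric] using assms(8)
      by (intro exp_product_SUP_tendsto_0[where K = "max K0 0"]) auto
  qed
qed

end
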